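(* Let $\kappa$ be a positive integer and $n=\kappa^2+1$. Let $A$ be an $n\times n$ $(0,1)$-matrix with all row and column sums equal to $\kappa$, and suppose $\Theta^m(A)=A$ for some integer $m\ge1$. Then: (L) $A$ is $J_2$-free; (S) $A$ is symmetric; (Z) all entries on the main diagonal of $A$ are $0$.
   Context: For an $n\times n$ integer matrix $X$ whose row and column sums all equal an integer $\lambda$, define $\Theta(X):=(\lambda-1)I_n+J_n-XX^{\mathrm T}$, where $I_n$ is the identity and $J_n$ the all-one matrix of order $n$. Then $\Theta(X)$ again has all row and column sums equal to a common integer ($n-\lambda^2+\lambda-1$), so $\Theta$ can be iterated; $\Theta^m$ denotes the $m$-fold iterate, each application using the common row/column sum of its argument. A $(0,1)$-matrix is $J_2$-free if it contains no $2\times 2$ all-one submatrix (i.e. no rows $i\ne l$ and columns $j\ne k$ with all four entries $(i,j),(i,k),(l,j),(l,k)$ equal to $1$). *)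

theory Defs
  imports "Jordan_Normal_Form.Matrix"
begin

definition has_line_sums :: "int mat \<Rightarrow> int \<Rightarrow> bool" where
  "has_line_sums X l \<longleftrightarrow>
     (\<forall>i<dim_row X. (\<Sum>j<dim_col X. X $$ (i, j)) = l) \<and>
     (\<forall>j<dim_col X. (\<Sum>i<dim_row X. X $$ (i, j)) = l)"

text \<open>The common row and column sum; meaningful only for nonempty matrices having one
  (see \<open>line_sum_eq\<close>).\<close>

definition line_sum :: "int mat \<Rightarrow> int" where
  "line_sum X = (THE l. has_line_sums X l)"

definition all_ones_mat :: "nat \<Rightarrow> int mat" where
  "all_ones_mat n = mat n n (\<lambda>_. 1)"

text \<open>The order \<open>n\<close> and the sum \<open>\<lambda>\<close> are read off from the argument, so that every
  application in an iterate \<open>Theta ^^ m\<close> uses the line sum of its own argument.\<close>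

definition Theta :: "int mat \<Rightarrow> int mat" where
  "Theta X = (line_sum X - 1) \<cdot>\<^sub>m 1\<^sub>m (dim_row X) + all_ones_mat (dim_row X)
               - X * transpose_mat X"

definition zero_one_mat :: "int mat \<Rightarrow> bool" where
  "zero_one_mat A \<longleftrightarrow> elements_mat A \<subseteq> {0, 1}"

definition J2_free :: "int mat \<Rightarrow> bool" where
  "J2_free A \<longleftrightarrow>
     \<not> (\<exists>i<dim_row A. \<exists>l<dim_row A. \<exists>j<dim_col A. \<exists>k<dim_col A. i \<noteq> l \<and> j \<noteq> k \<and>
         A $$ (i, j) = 1 \<and> A $$ (i, k) = 1 \<and> A $$ (l, j) = 1 \<and> A $$ (l, k) = 1)"

lemma line_sum_eq:
  assumes "X \<in> carrier_mat n n" "n > 0" "has_line_sums X l"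
  shows "line_sum X = l"
  unfolding line_sum_def
proof (rule the_equality[of _ l])
  show "l' = l" if "has_line_sums X l'" for l'
    using that assms unfolding has_line_sums_def by force
qed (fact assms(3))

lemma Theta_carrier:
  assumes "X \<in> carrier_mat n n"
  shows "Theta X \<in> carrier_mat n n"
  using assms by (auto simp: Theta_def all_ones_mat_def)

lemma Theta_has_line_sums:
  assumes X: "X \<in> carrier_mat n n" and n: "n > 0" and l: "has_line_sums X l"
  shows "has_line_sums (Theta X) (int n - l^2 + l - 1)"
proof -
  have dim: "dim_row X = n" "dim_col X = n" using X by auto
  have dimT: "dim_row (Theta X) = n" "dim_col (Theta X) = n"
    using Theta_carrier[OF X] by auto
  have rows: "(\<Sum>j<n. X $$ (i, j)) = l" if "i < n" for i
    using l that dim by (auto simp: has_line_sums_def)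
  have cols: "(\<Sum>i<n. X $$ (i, j)) = l" if "j < n" for j
    using l that dim by (auto simp: has_line_sums_def)
  have ent: "Theta X $$ (i, j) = (if i = j then l - 1 else 0) + 1
      - (\<Sum>k<n. X $$ (i, k) * X $$ (j, k))" if "i < n" "j < n" for i j
    using that dim line_sum_eq[OF X n l]
    by (simp add: Theta_def all_ones_mat_def scalar_prod_def atLeast0LessThan)
  have sq: "(\<Sum>j<n. \<Sum>k<n. X $$ (i, k) * X $$ (j, k)) = l^2" if i: "i < n" for i
  proof -
    have "(\<Sum>j<n. \<Sum>k<n. X $$ (i, k) * X $$ (j, k)) = (\<Sum>k<n. X $$ (i, k) * (\<Sum>j<n. X $$ (j, k)))"
      by (subst sum.swap) (simp add: sum_distrib_left)
    also have "\<dots> = (\<Sum>k<n. X $$ (i, k)) * l"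
      by (simp add: cols sum_distrib_right)
    finally show ?thesis using rows[OF i] by (simp add: power2_eq_square)
  qed
  have row: "(\<Sum>j<n. Theta X $$ (i, j)) = int n - l^2 + l - 1" if i: "i < n" for i
    using i by (simp add: ent sum_subtractf sum.distrib sq)
  have "Theta X $$ (i, j) = Theta X $$ (j, i)" if "i < n" "j < n" for i j
    using that by (simp add: ent mult.commute)
  then have "(\<Sum>i<n. Theta X $$ (i, j)) = (\<Sum>i<n. Theta X $$ (j, i))" if "j < n" for j
    using that by (intro sum.cong) auto
  with row show ?thesis unfolding has_line_sums_def dimT by auto
qed

end

theory Submission
  imports Defs
begin

text \<open>
  For \<open>n = \<kappa>\<^sup>2 + 1\<close> the map \<open>\<Theta>\<close> preserves the line sum \<open>\<kappa>\<close>. The \<open>i\<close>-th diagonal entry of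
  \<open>\<Theta>(X)\<close> is \<open>\<kappa>\<close> minus the sum of squares of the \<open>i\<close>-th row of \<open>X\<close>, that is, the sum of the
  integers \<open>x - x\<^sup>2 \<le> 0\<close> over the entries \<open>x\<close> of that row. So it is at most \<open>0\<close>, with equality
  only if the row is a \<open>(0,1)\<close>-row. Hence the periodic \<open>(0,1)\<close>-matrix \<open>A\<close>, being a value of
  \<open>\<Theta>\<close>, has zero diagonal, and going backwards along the orbit every iterate is a
  \<open>(0,1)\<close>-matrix. In particular the off-diagonal entries of \<open>\<Theta>(A)\<close> are nonnegative, which
  says that two distinct rows of \<open>A\<close> have inner product at most \<open>1\<close>.
\<close>

lemma zero_one_mat_iff:
  assumes "X \<in> carrier_mat n n"
  shows "zero_one_mat X \<longleftrightarrow> (\<forall>i<n. \<forall>j<n. X $$ (i, j) = 0 \<or> X $$ (i, j) = 1)"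
proof -
  have "zero_one_mat X \<longleftrightarrow> (\<forall>i<n. \<forall>j<n. X $$ (i, j) \<in> {0, 1})"
    using assms unfolding zero_one_mat_def elements_mat_def by fastforce
  then show ?thesis by simp
qed

lemma int_le_square: "(x::int) \<le> x\<^sup>2"
  by (cases "x \<le> 0") (auto simp: power2_eq_square intro: order_trans)

lemma Theta_index:
  assumes "X \<in> carrier_mat n n" "n > 0" "has_line_sums X l" "i < n" "j < n"
  shows "Theta X $$ (i, j) = (if i = j then l else 1) - (\<Sum>k<n. X $$ (i, k) * X $$ (j, k))"
  using assms line_sum_eq[OF assms(1-3)]
  by (simp add: Theta_def all_ones_mat_def scalar_prod_def atLeast0LessThan)

lemma transpose_Theta:
  assumes "X \<in> carrier_mat n n" "n > 0" "has_line_sums X l"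
  shows "transpose_mat (Theta X) = Theta X"
  using Theta_carrier[OF assms(1)]
  by (intro eq_matI) (auto simp: Theta_index[OF assms] mult.commute)

lemma Theta_diag:
  assumes "X \<in> carrier_mat n n" "n > 0" "has_line_sums X l" "i < n"
  shows "Theta X $$ (i, i) = (\<Sum>k<n. X $$ (i, k) - (X $$ (i, k))\<^sup>2)"
proof -
  have "(\<Sum>k<n. X $$ (i, k)) = l"
    using assms by (auto simp: has_line_sums_def)
  then show ?thesis
    by (simp add: Theta_index[OF assms assms(4)] sum_subtractf power2_eq_square)
qed

lemma Theta_diag_nonpos:
  assumes "X \<in> carrier_mat n n" "n > 0" "has_line_sums X l" "i < n"
  shows "Theta X $$ (i, i) \<le> 0"
  unfolding Theta_diag[OF assms] by (intro sum_nonpos) (simp add: int_le_square)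

lemma zero_one_mat_if_Theta_diag_nonneg:
  assumes "X \<in> carrier_mat n n" "n > 0" "has_line_sums X l"
    and nonneg: "\<And>i. i < n \<Longrightarrow> 0 \<le> Theta X $$ (i, i)"
  shows "zero_one_mat X"
  unfolding zero_one_mat_iff[OF assms(1)]
proof (intro allI impI)
  fix i j assume i: "i < n" and j: "j < n"
  \<comment> \<open>The sign is flipped to make every summand nonnegative, so a zero sum forces each
    term to vanish.\<close>
  have "(\<Sum>k<n. (X $$ (i, k))\<^sup>2 - X $$ (i, k)) = - Theta X $$ (i, i)"
    unfolding Theta_diag[OF assms(1-3) i] by (simp add: sum_subtractf)
  also have "\<dots> = 0"
    using nonneg[OF i] Theta_diag_nonpos[OF assms(1-3) i] by simp
  finally have "(X $$ (i, j))\<^sup>2 - X $$ (i, j) = 0"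
    using j by (subst (asm) sum_nonneg_eq_0_iff) (auto simp: int_le_square)
  then have "X $$ (i, j) * (X $$ (i, j) - 1) = 0"
    by (simp add: power2_eq_square algebra_simps)
  then show "X $$ (i, j) = 0 \<or> X $$ (i, j) = 1"
    by auto
qed

lemma J2_free_if_zero_one_mat_Theta:
  assumes X: "X \<in> carrier_mat n n" "n > 0" "has_line_sums X l"
    and zo: "zero_one_mat X" and zoT: "zero_one_mat (Theta X)"
  shows "J2_free X"
  unfolding J2_free_def
proof (intro notI, elim exE conjE)
  fix i r j k
  assume "i < dim_row X" "r < dim_row X" "j < dim_col X" "k < dim_col X"
    and ne: "i \<noteq> r" "j \<noteq> k"
    and ones: "X $$ (i, j) = 1" "X $$ (i, k) = 1" "X $$ (r, j) = 1" "X $$ (r, k) = 1"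
  then have lt: "i < n" "r < n" "j < n" "k < n"
    using X(1) by auto
  \<comment> \<open>Columns \<open>j\<close> and \<open>k\<close> alone contribute 2, which pushes
    the off-diagonal entry \<open>1 - 2\<close> or lower.\<close>
  have "2 = (\<Sum>c\<in>{j, k}. X $$ (i, c) * X $$ (r, c))"
    using ne ones by simp
  also have "\<dots> \<le> (\<Sum>c<n. X $$ (i, c) * X $$ (r, c))"
  proof (rule sum_mono2)
    fix c assume "c \<in> {..<n} - {j, k}"
    then have "X $$ (i, c) \<in> {0, 1}" "X $$ (r, c) \<in> {0, 1}"
      using zo lt unfolding zero_one_mat_iff[OF X(1)] by simp_all
    then show "0 \<le> X $$ (i, c) * X $$ (r, c)"
      by auto
  qed (use lt in auto)
  finally have "Theta X $$ (i, r) < 0"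
    using ne by (simp add: Theta_index[OF X lt(1,2)])
  then show False
    using zoT lt unfolding zero_one_mat_iff[OF Theta_carrier[OF X(1)]] by fastforce
qed

theorem theorem1p4:
  fixes \<kappa> n m :: nat and A :: "int mat"
  assumes "\<kappa> > 0" and "n = \<kappa>^2 + 1"
    and "A \<in> carrier_mat n n"
    and "zero_one_mat A"
    and "has_line_sums A (int \<kappa>)"
    and "m \<ge> 1" and "(Theta ^^ m) A = A"
  shows "J2_free A \<and> transpose_mat A = A \<and> (\<forall>i<n. A $$ (i, i) = 0)"
proof -
  have n: "n > 0" using assms(2) by simp
  \<comment> \<open>The choice of \<open>n\<close> makes \<open>\<kappa>\<close> a fixed point of
    the line sum map.\<close>
  have iter: "(Theta ^^ t) A \<in> carrier_mat n n \<and> has_line_sums ((Theta ^^ t) A) (int \<kappa>)" for t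
  proof (induction t)
    case (Suc t)
    then show ?case
      using Theta_carrier[of "(Theta ^^ t) A" n] n assms(2)
        Theta_has_line_sums[of "(Theta ^^ t) A" n "int \<kappa>"] by simp
  qed (use assms in simp)
  have zo: "zero_one_mat ((Theta ^^ t) A)" if "t \<le> m" for t
    using that
  \<comment> \<open>Downward from \<open>t = m\<close>, where periodicity returns \<open>A\<close>
    itself.\<close>
  proof (induction t rule: inc_induct)
    case (step t)
    let ?X = "(Theta ^^ t) A"
    have "zero_one_mat (Theta ?X)" using step by simp
    then have "0 \<le> Theta ?X $$ (i, i)" if "i < n" for i
      using that iter[of t] unfolding zero_one_mat_iff[OF Theta_carrier[OF conjunct1[OF iter]]]
      by force
    then show ?case
      using zero_one_mat_if_Theta_diag_nonneg iter[of t] n by blast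
  qed (use assms in simp)
  have "zero_one_mat (Theta A)"
    using zo[of 1] assms(6) by simp
  then have "J2_free A"
    using J2_free_if_zero_one_mat_Theta assms(3-5) n by blast
  \<comment> \<open>\<open>B\<close> is the predecessor of \<open>A\<close> on its cycle; it exists
    because \<open>m \<ge> 1\<close>.\<close>
  moreover obtain B where B: "B \<in> carrier_mat n n" "has_line_sums B (int \<kappa>)" "Theta B = A"
    using iter[of "m - 1"] assms(6,7) by (cases m) auto
  then have "transpose_mat A = A"
    using transpose_Theta n by blast
  moreover have "A $$ (i, i) = 0" if "i < n" for i
  proof -
    have "A $$ (i, i) \<le> 0"
      using Theta_diag_nonpos[OF B(1) n B(2) that] B(3) by simp
    then show ?thesis
      using assms(4) that unfolding zero_one_mat_iff[OF assms(3)] by force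
  qed
  ultimately show ?thesis by blast
qed

end
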